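(* For any integer $d \geq 1$ and any graph $F$, \[\frac{(1 + o(1))}{|V(F)|}\, \alpha_d \leq \iota(d, F) \leq \alpha_d ,\] where $\alpha_d = \frac{1 + \ln(d+1)}{d+1}$ and $o(1)$ represents a function of $d$ (for fixed $F$) that tends to $0$ as $d \rightarrow \infty$.
   Context: Graphs are finite, simple and undirected, with non-empty vertex set (except that deleting vertices may yield the null graph). For a graph $G$, $\delta(G)$ is its minimum degree. For $D \subseteq V(G)$, $N[D]$ denotes the closed neighbourhood of $D$ in $G$. A graph contains a copy of $F$ if it has a (not necessarily induced) subgraph isomorphic to $F$. A set $D \subseteq V(G)$ is an $F$-isolating set of $G$ if $G - N[D]$ contains no copy of $F$. $\iota(G,F)$ denotes the size of a smallest $F$-isolating set of $G$. For an integer $d \geq 1$ and a graph $F$, \[\iota(d, F) = \inf\{\alpha \colon \iota(G, F) \leq \alpha |V(G)| \mbox{ for every graph } G \mbox{ with } \delta(G) \geq d\}.\] *)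

theory Defs
  imports Complex_Main
begin

datatype 'a graph = Graph (verts: "'a set") (edges: "'a set set")

(* Finite simple undirected graphs. The null graph is admitted here, since deleting vertices may
   produce it; non-emptiness of the vertex set is the extra condition in nonnull_graph. *)
definition fin_graph :: "'a graph \<Rightarrow> bool" where
  "fin_graph G \<longleftrightarrow> finite (verts G) \<and> (\<forall>e\<in>edges G. e \<subseteq> verts G \<and> card e = 2)"

definition nonnull_graph :: "'a graph \<Rightarrow> bool" where
  "nonnull_graph G \<longleftrightarrow> fin_graph G \<and> verts G \<noteq> {}"

definition nbhd :: "'a graph \<Rightarrow> 'a \<Rightarrow> 'a set" where
  "nbhd G v = {u \<in> verts G. {u, v} \<in> edges G}"

definition closed_nbhd :: "'a graph \<Rightarrow> 'a set \<Rightarrow> 'a set" where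
  "closed_nbhd G D = D \<union> (\<Union>v\<in>D. nbhd G v)"

definition degree :: "'a graph \<Rightarrow> 'a \<Rightarrow> nat" where
  "degree G v = card (nbhd G v)"

definition min_degree :: "'a graph \<Rightarrow> nat" where
  "min_degree G = Min (degree G ` verts G)"

definition delete_verts :: "'a graph \<Rightarrow> 'a set \<Rightarrow> 'a graph" where
  "delete_verts G X = Graph (verts G - X) {e \<in> edges G. e \<inter> X = {}}"

definition subgraph :: "'a graph \<Rightarrow> 'a graph \<Rightarrow> bool" where
  "subgraph H G \<longleftrightarrow> fin_graph H \<and> verts H \<subseteq> verts G \<and> edges H \<subseteq> edges G"

definition isomorphic :: "'a graph \<Rightarrow> 'b graph \<Rightarrow> bool" where
  "isomorphic G H \<longleftrightarrow> (\<exists>f. bij_betw f (verts G) (verts H) \<and>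
     (\<forall>u\<in>verts G. \<forall>v\<in>verts G. {u, v} \<in> edges G \<longleftrightarrow> {f u, f v} \<in> edges H))"

definition contains_copy :: "'a graph \<Rightarrow> 'b graph \<Rightarrow> bool" where
  "contains_copy G F \<longleftrightarrow> (\<exists>H. subgraph H G \<and> isomorphic H F)"

definition isolating :: "'b graph \<Rightarrow> 'a graph \<Rightarrow> 'a set \<Rightarrow> bool" where
  "isolating F G D \<longleftrightarrow>
     D \<subseteq> verts G \<and> \<not> contains_copy (delete_verts G (closed_nbhd G D)) F"

(* For F with at least one vertex the set of candidate sizes is non-empty, as D = verts G is
   always isolating. *)
definition isolation_number :: "'a graph \<Rightarrow> 'b graph \<Rightarrow> nat" where
  "isolation_number G F = (LEAST k. \<exists>D. isolating F G D \<and> card D = k)"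

(* Vertices of G are taken to be natural numbers: every finite graph is isomorphic to such a
   graph, and minimum degree, order and isolation number are isomorphism invariants. *)
definition iota :: "nat \<Rightarrow> 'b graph \<Rightarrow> real" where
  "iota d F = Inf {a :: real. \<forall>G :: nat graph. nonnull_graph G \<and> min_degree G \<ge> d \<longrightarrow>
     real (isolation_number G F) \<le> a * real (card (verts G))}"

definition alpha :: "nat \<Rightarrow> real" where
  "alpha d = (1 + ln (real d + 1)) / (real d + 1)"

end

theory Submission imports Defs "HOL-Real_Asymp.Real_Asymp" begin

text \<open>
  Both bounds come from one greedy covering argument: if every object of a finite family is hit by
  at least a fraction \<open>q\<close> of the available choices, then \<open>t\<close> greedily made choices leave at most a
  fraction \<open>(1 - q)\<^sup>t\<close> of the objects unhit (\<open>greedy_covering\<close>).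

  For the upper bound, a dominating set leaves no vertices for a copy of \<open>F\<close>. If \<open>G\<close> has \<open>n\<close> vertices
  and minimum degree at least \<open>d\<close>, each vertex is dominated by at least a fraction \<open>q = (d + 1) / n\<close> of the
  vertices. Taking \<open>t\<close> greedy vertices together with the vertices that they leave undominated gives a
  dominating set of size at most \<open>t + n (1 - q)\<^sup>t\<close>, and \<open>t\<close> close to \<open>n ln (d + 1) / (d + 1)\<close>
  brings this down to \<open>\<alpha>\<^sub>d n\<close> (\<open>small_dominating_set\<close>).

  For the lower bound, fix \<open>\<epsilon>\<close> and let \<open>A\<close> have \<open>a = d\<^sup>2\<close> points. A set of
  \<open>m = (1 - \<epsilon>) d ln d\<close> points of \<open>A\<close> is missed by a fraction of about
  \<open>(1 - m / a)\<^sup>d \<approx> d powr (\<epsilon> - 1)\<close> of the \<open>d\<close>-subsets of \<open>A\<close>. Greedy covering, now with the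
  \<open>m\<close>-sets as objects and the \<open>d\<close>-subsets as choices, therefore yields a family of only \<open>b = o(a)\<close>
  \<open>d\<close>-subsets \<open>S\<^sub>i\<close> such that every set of \<open>m\<close> points misses one of them (\<open>large_transversal_family\<close>).
  Make \<open>A\<close> a clique and attach to each \<open>S\<^sub>i\<close> a private clique \<open>C\<^sub>i\<close> of order \<open>|V(F)|\<close>, completely
  joined to \<open>S\<^sub>i\<close>. An isolating set must meet every \<open>S\<^sub>i \<union> C\<^sub>i\<close>, which is the closed
  neighbourhood of each vertex of \<open>C\<^sub>i\<close>, as otherwise the whole of \<open>C\<^sub>i\<close>, and with it a copy of \<open>F\<close>, survives; moving its
  vertices in the \<open>C\<^sub>i\<close> into the \<open>S\<^sub>i\<close> turns it into a transversal of the family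
  (\<open>graph_of_hypergraph\<close>). So the isolation number exceeds \<open>m\<close>, while the order
  \<open>a + b |V(F)|\<close> is \<open>(1 + o(1)) d\<^sup>2\<close>, and \<open>m / d\<^sup>2\<close> is \<open>(1 - \<epsilon> + o(1)) \<alpha>\<^sub>d\<close>.

  The lower bound obtained in this way is \<open>(1 + o(1)) \<alpha>\<^sub>d\<close>, and the factor \<open>1 / |V(F)|\<close> only
  decreases it.
\<close>

section \<open>Greedy covering\<close>

text \<open>
  By double counting, some choice hits at least a fraction \<open>q\<close> of the objects not yet hit, so
  each greedy step multiplies their number by at most \<open>1 - q\<close>.
\<close>

lemma greedy_covering:
  fixes q :: real
  assumes fin: "finite P" "finite Q" and "Q \<noteq> {}" and "q \<le> 1"
    and dense: "\<And>x. x \<in> P \<Longrightarrow> q * real (card Q) \<le> real (card {y\<in>Q. R x y})"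
  shows "\<exists>f. (\<forall>i<t. f i \<in> Q) \<and>
    real (card {x\<in>P. \<forall>i<t. \<not> R x (f i)}) \<le> (1 - q) ^ t * real (card P)"
proof (induction t)
  case 0
  then show ?case by simp
next
  case (Suc t)
  then obtain f where f: "\<And>i. i < t \<Longrightarrow> f i \<in> Q"
    and le: "real (card {x\<in>P. \<forall>i<t. \<not> R x (f i)}) \<le> (1 - q) ^ t * real (card P)"
    by auto
  define U where "U = {x\<in>P. \<forall>i<t. \<not> R x (f i)}"
  have finU: "finite U" and UP: "U \<subseteq> P" using fin by (auto simp: U_def)
  have "\<exists>y\<in>Q. q * real (card U) \<le> real (card {x\<in>U. R x y})"
  proof (rule ccontr)
    assume "\<not> ?thesis"
    then have "(\<Sum>y\<in>Q. real (card {x\<in>U. R x y})) < (\<Sum>y\<in>Q. q * real (card U))"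
      using fin \<open>Q \<noteq> {}\<close> by (intro sum_strict_mono) auto
    moreover have "(\<Sum>y\<in>Q. card {x\<in>U. R x y}) = (\<Sum>x\<in>U. card {y\<in>Q. R x y})"
      using sum_multicount_gen[OF fin(2) finU, of "\<lambda>y x. R x y" "\<lambda>x. card {y\<in>Q. R x y}"] by simp
    then have "(\<Sum>y\<in>Q. real (card {x\<in>U. R x y})) = (\<Sum>x\<in>U. real (card {y\<in>Q. R x y}))"
      by (simp flip: of_nat_sum)
    moreover have "(\<Sum>x\<in>U. q * real (card Q)) \<le> (\<Sum>x\<in>U. real (card {y\<in>Q. R x y}))"
      using UP by (intro sum_mono dense) auto
    ultimately show False by (simp add: mult_ac)
  qed
  then obtain y where y: "y \<in> Q" "q * real (card U) \<le> real (card {x\<in>U. R x y})" by blast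
  define g where "g = f(t := y)"
  have "{x\<in>P. \<forall>i<Suc t. \<not> R x (g i)} = U - {x\<in>U. R x y}"
    by (auto simp: U_def g_def less_Suc_eq)
  then have "real (card {x\<in>P. \<forall>i<Suc t. \<not> R x (g i)}) = real (card U) - real (card {x\<in>U. R x y})"
    using finU by (simp add: card_Diff_subset card_mono)
  also have "\<dots> \<le> (1 - q) * real (card U)"
    using y by (simp add: algebra_simps)
  also have "\<dots> \<le> (1 - q) * ((1 - q) ^ t * real (card P))"
    using le \<open>q \<le> 1\<close> unfolding U_def by (intro mult_left_mono) auto
  finally show ?case
    using f y(1) by (intro exI[of _ g]) (auto simp: g_def less_Suc_eq)
qed

section \<open>Isolating sets and unions of cliques\<close>

lemma min_degree_ge_iff:
  assumes "nonnull_graph G"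
  shows "d \<le> min_degree G \<longleftrightarrow> (\<forall>v\<in>verts G. d \<le> degree G v)"
  using assms by (simp add: min_degree_def nonnull_graph_def fin_graph_def)

lemma isolating_if_dominating:
  fixes G :: "'a graph"
  assumes "nonnull_graph F" "D \<subseteq> verts G" "verts G \<subseteq> closed_nbhd G D"
  shows "isolating F G D"
proof -
  have "\<not> bij_betw f (verts H) (verts F)"
    if "verts H \<subseteq> verts G - closed_nbhd G D" for H :: "'a graph" and f
  proof -
    have "verts H = {}" using that assms(3) by blast
    then show ?thesis using assms(1) by (auto simp: bij_betw_def nonnull_graph_def)
  qed
  then show ?thesis
    using assms(2)
    by (auto simp: isolating_def contains_copy_def subgraph_def isomorphic_def delete_verts_def)
qed

lemma isolation_number_attained:
  assumes "nonnull_graph F"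
  obtains D where "isolating F G D" "card D = isolation_number G F"
proof -
  have "isolating F G (verts G)"
    using assms by (intro isolating_if_dominating) (auto simp: closed_nbhd_def)
  then have "\<exists>k D. isolating F G D \<and> card D = k" by blast
  from LeastI_ex[OF this] show thesis
    using that unfolding isolation_number_def by blast
qed

lemma isolation_number_le: "isolating F G D \<Longrightarrow> isolation_number G F \<le> card D"
  unfolding isolation_number_def by (rule Least_le) blast

lemma contains_copy_if_clique:
  assumes F: "fin_graph F" and C: "finite C" "C \<subseteq> verts G" "card C = card (verts F)"
    and clique: "\<And>e. e \<subseteq> C \<Longrightarrow> card e = 2 \<Longrightarrow> e \<in> edges G"
  shows "contains_copy G F"
proof -
  obtain f where f: "bij_betw f C (verts F)"
    using F C finite_same_card_bij[of C "verts F"] by (auto simp: fin_graph_def)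
  define H where "H = Graph C {e. e \<subseteq> C \<and> card e = 2 \<and> f ` e \<in> edges F}"
  have "{u, v} \<in> edges H \<longleftrightarrow> {f u, f v} \<in> edges F" if "u \<in> C" "v \<in> C" for u v
  proof -
    have "card {u, v} = 2" if "{f u, f v} \<in> edges F"
      using F that by (cases "u = v") (auto simp: fin_graph_def)
    then show ?thesis using that by (auto simp: H_def)
  qed
  then have "isomorphic H F"
    using f unfolding isomorphic_def by (intro exI[of _ f]) (simp add: H_def)
  moreover have "subgraph H G"
    using C clique by (auto simp: subgraph_def H_def fin_graph_def)
  ultimately show ?thesis unfolding contains_copy_def by blast
qed

text \<open>
  Describing the extremal graph as a union of cliques makes degrees and neighbourhoods immediate:
  the closed neighbourhood of a vertex is the union of the cliques through it.
\<close>

definition clique_union :: "'a set \<Rightarrow> 'a set set \<Rightarrow> 'a graph" where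
  "clique_union V \<K> = Graph V {e. card e = 2 \<and> (\<exists>K\<in>\<K>. e \<subseteq> K)}"

lemma verts_clique_union [simp]: "verts (clique_union V \<K>) = V"
  by (simp add: clique_union_def)

lemma nonnull_clique_union:
  assumes "finite V" "V \<noteq> {}" "\<Union>\<K> \<subseteq> V"
  shows "nonnull_graph (clique_union V \<K>)"
  using assms by (auto simp: nonnull_graph_def fin_graph_def clique_union_def)

lemma min_degree_clique_union:
  assumes V: "finite V" "V \<noteq> {}" and \<K>: "\<Union>\<K> = V" and large: "\<And>K. K \<in> \<K> \<Longrightarrow> d < card K"
  shows "d \<le> min_degree (clique_union V \<K>)"
proof -
  have "d \<le> degree (clique_union V \<K>) v" if "v \<in> V" for v
  proof -
    obtain K where K: "K \<in> \<K>" "v \<in> K" using \<K> \<open>v \<in> V\<close> by blast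
    have "K - {v} \<subseteq> nbhd (clique_union V \<K>) v"
      using K \<K> by (auto simp: nbhd_def clique_union_def)
    moreover have "finite (nbhd (clique_union V \<K>) v)"
      using V by (simp add: nbhd_def)
    ultimately have "card (K - {v}) \<le> degree (clique_union V \<K>) v"
      unfolding degree_def by (rule card_mono[rotated])
    then show ?thesis
      using large[OF K(1)] K(2) by simp
  qed
  then show ?thesis
    using V \<K> by (simp add: min_degree_ge_iff nonnull_clique_union)
qed

text \<open>
  Without such a graph the infimum defining \<^const>\<open>iota\<close> would range over all reals.
\<close>

lemma exists_min_degree_ge:
  obtains G :: "nat graph" where "nonnull_graph G" "d \<le> min_degree G"
proof
  show "nonnull_graph (clique_union {..d} {{..d}})"
    by (rule nonnull_clique_union) auto
  show "d \<le> min_degree (clique_union {..d} {{..d}})"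
    by (rule min_degree_clique_union) auto
qed

lemma alpha_pos: "0 < alpha d"
proof -
  have "0 \<le> ln (real d + 1)" by simp
  then show ?thesis by (simp add: alpha_def add_pos_nonneg)
qed

section \<open>The upper bound by small dominating sets\<close>

text \<open>
  The optimal number \<open>T = ln (d + 1) / q\<close> of greedy steps is rarely an integer, and rounding it would cost up to one
  vertex. This loss is avoided by interpolating the size bound \<open>c\<close> between the two integers next to
  \<open>T\<close>: the interpolated value is at most \<open>T + n exp (- q T) = \<alpha>\<^sub>d n\<close>, hence so is \<open>c\<close> at one of them.
\<close>

lemma small_dominating_set:
  fixes G :: "'a graph"
  assumes G: "nonnull_graph G" and deg: "d \<le> min_degree G"
  obtains D where "D \<subseteq> verts G" "verts G \<subseteq> closed_nbhd G D"
    "real (card D) \<le> alpha d * real (card (verts G))"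
proof -
  define V where "V = verts G"
  define n where "n = real (card V)"
  define q where "q = (real d + 1) / n"
  define T where "T = ln (real d + 1) / q"
  define R where "R = (\<lambda>x y. x \<in> closed_nbhd G {y})"
  have V: "finite V" "V \<noteq> {}"
    using G by (auto simp: V_def nonnull_graph_def fin_graph_def)
  then have n: "0 < n" by (simp add: n_def card_gt_0_iff)
  have nb: "real d + 1 \<le> real (card {y\<in>V. R x y})" if "x \<in> V" for x
  proof -
    have "x \<notin> nbhd G x"
      using G by (force simp: nbhd_def nonnull_graph_def fin_graph_def)
    moreover have "finite (nbhd G x)" using V by (simp add: nbhd_def V_def)
    moreover have "{y\<in>V. R x y} = insert x (nbhd G x)"
      using that by (auto simp: R_def V_def closed_nbhd_def nbhd_def insert_commute)
    ultimately have "card {y\<in>V. R x y} = Suc (degree G x)"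
      by (simp add: degree_def)
    moreover have "d \<le> degree G x"
      using deg that min_degree_ge_iff[OF G] by (simp add: V_def)
    ultimately show ?thesis by simp
  qed
  have q: "0 < q" "q \<le> 1"
  proof -
    show "0 < q" using n by (simp add: q_def)
    obtain x where "x \<in> V" using V by blast
    from nb[OF this] have "real d + 1 \<le> n"
      using card_mono[OF V(1), of "{y\<in>V. R x y}"] unfolding n_def by fastforce
    then show "q \<le> 1" using n by (simp add: q_def)
  qed
  have greedy: "\<exists>D. D \<subseteq> V \<and> V \<subseteq> closed_nbhd G D \<and> real (card D) \<le> real t + (1 - q) ^ t * n" for t
  proof -
    have "\<exists>f. (\<forall>i<t. f i \<in> V) \<and>
        real (card {x\<in>V. \<forall>i<t. \<not> R x (f i)}) \<le> (1 - q) ^ t * real (card V)"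
      using V q nb n by (intro greedy_covering) (auto simp: q_def n_def[symmetric])
    then obtain f where f: "\<forall>i<t. f i \<in> V"
      and left: "real (card {x\<in>V. \<forall>i<t. \<not> R x (f i)}) \<le> (1 - q) ^ t * n"
      unfolding n_def by blast
    define D where "D = f ` {..<t} \<union> {x\<in>V. \<forall>i<t. \<not> R x (f i)}"
    have "card D \<le> t + card {x\<in>V. \<forall>i<t. \<not> R x (f i)}"
      unfolding D_def using card_image_le[of "{..<t}" f]
      by (intro order_trans[OF card_Un_le]) simp
    then have "real (card D) \<le> real t + (1 - q) ^ t * n"
      using left by linarith
    moreover have "D \<subseteq> V" using f by (auto simp: D_def)
    moreover have "V \<subseteq> closed_nbhd G D"
      by (auto simp: D_def R_def closed_nbhd_def)
    ultimately show ?thesis by blast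
  qed
  define t where "t = nat \<lfloor>T\<rfloor>"
  define \<theta> where "\<theta> = T - real t"
  have T: "T = ln (real d + 1) / (real d + 1) * n" by (simp add: T_def q_def)
  have "0 \<le> T" using q by (simp add: T_def)
  then have \<theta>: "0 \<le> \<theta>" "\<theta> \<le> 1" unfolding \<theta>_def t_def by linarith+
  define c where "c = (\<lambda>s. real s + (1 - q) ^ s * n)"
  have "(1 - \<theta>) * c t + \<theta> * c (Suc t) = T + (1 - q) ^ t * (1 - \<theta> * q) * n"
    by (simp add: c_def \<theta>_def algebra_simps)
  also have "(1 - q) ^ t * (1 - \<theta> * q) \<le> exp (- q) ^ t * exp (- (\<theta> * q))"
    using q \<theta> exp_ge_add_one_self[of "- q"] exp_ge_add_one_self[of "- (\<theta> * q)"]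
    by (intro mult_mono power_mono) (auto simp: mult_le_one)
  also have "\<dots> = exp (- (q * T))"
    by (simp add: \<theta>_def exp_of_nat_mult[symmetric] exp_add[symmetric] algebra_simps)
  also have "\<dots> = 1 / (real d + 1)"
    using q by (simp add: T_def exp_minus field_simps)
  also have "T + 1 / (real d + 1) * n = alpha d * n"
    by (simp add: T alpha_def add_divide_distrib ring_distribs)
  finally have mean: "(1 - \<theta>) * c t + \<theta> * c (Suc t) \<le> alpha d * n"
    using n by simp
  have "\<exists>s. c s \<le> alpha d * n"
  proof (rule ccontr)
    assume "\<not> ?thesis"
    then have "alpha d * n < c t" "alpha d * n < c (Suc t)" by (auto simp: not_le)
    then have "(1 - \<theta>) * (c t - alpha d * n) + \<theta> * (c (Suc t) - alpha d * n) > 0"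
      using \<theta> by (cases "\<theta> = 0") (auto intro: add_nonneg_pos)
    then show False using mean by (simp add: algebra_simps)
  qed
  then obtain s where "c s \<le> alpha d * n" ..
  with greedy[of s] that show thesis
    unfolding c_def V_def n_def by (meson order_trans)
qed

lemma isolation_number_le_alpha:
  assumes "nonnull_graph F" "nonnull_graph G" "d \<le> min_degree G"
  shows "real (isolation_number G F) \<le> alpha d * real (card (verts G))"
proof -
  obtain D where "D \<subseteq> verts G" "verts G \<subseteq> closed_nbhd G D"
    "real (card D) \<le> alpha d * real (card (verts G))"
    using small_dominating_set assms by blast
  then show ?thesis
    using isolation_number_le[OF isolating_if_dominating[OF assms(1)], of D G] by linarith
qed

lemma iota_le_alpha:
  assumes F: "nonnull_graph F"
  shows "iota d F \<le> alpha d"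
  unfolding iota_def
proof (rule cInf_lower)
  show "alpha d \<in> {a. \<forall>G :: nat graph. nonnull_graph G \<and> min_degree G \<ge> d \<longrightarrow>
     real (isolation_number G F) \<le> a * real (card (verts G))}"
    using isolation_number_le_alpha[OF F] by blast
  obtain K :: "nat graph" where K: "nonnull_graph K" "d \<le> min_degree K"
    using exists_min_degree_ge .
  have "0 \<le> a" if "real (isolation_number K F) \<le> a * real (card (verts K))" for a :: real
    using order_trans[OF of_nat_0_le_iff that] K(1)
    by (auto simp: zero_le_mult_iff nonnull_graph_def fin_graph_def card_eq_0_iff)
  then show "bdd_below {a. \<forall>G :: nat graph. nonnull_graph G \<and> min_degree G \<ge> d \<longrightarrow>
     real (isolation_number G F) \<le> a * real (card (verts G))}"
    using K by (intro bdd_belowI[of _ 0]) blast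
qed

lemma iota_ge:
  fixes G :: "nat graph"
  assumes F: "nonnull_graph F" and G: "nonnull_graph G" "d \<le> min_degree G"
    and le: "x * real (card (verts G)) \<le> real (isolation_number G F)"
  shows "x \<le> iota d F"
  unfolding iota_def
proof (rule cInf_greatest)
  show "{a. \<forall>G :: nat graph. nonnull_graph G \<and> min_degree G \<ge> d \<longrightarrow>
     real (isolation_number G F) \<le> a * real (card (verts G))} \<noteq> {}"
    using isolation_number_le_alpha[OF F] by blast
  fix a assume "a \<in> {a. \<forall>G :: nat graph. nonnull_graph G \<and> min_degree G \<ge> d \<longrightarrow>
     real (isolation_number G F) \<le> a * real (card (verts G))}"
  then have "x * real (card (verts G)) \<le> a * real (card (verts G))"
    using G le by fastforce
  moreover have "0 < card (verts G)"
    using G by (auto simp: nonnull_graph_def fin_graph_def card_gt_0_iff)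
  ultimately show "x \<le> a" by simp
qed

lemma iota_nonneg: "nonnull_graph F \<Longrightarrow> 0 \<le> iota d F"
  by (metis exists_min_degree_ge iota_ge mult_zero_left of_nat_0_le_iff)

section \<open>The lower bound by hypergraphs with large transversal number\<close>

text \<open>
  The vertices below \<open>a\<close> form the ground set of the hypergraph; the next \<open>b |V(F)|\<close> numbers are cut
  into consecutive blocks \<open>C i\<close> of size \<open>|V(F)|\<close>, one for each hyperedge. Only the cliques
  \<open>S i \<union> C i\<close> contain vertices of \<open>C i\<close>, so a set that avoids \<open>S i \<union> C i\<close> leaves the clique
  \<open>C i\<close> intact. The map \<open>h\<close>, which replaces each vertex of \<open>C i\<close> by a fixed vertex of \<open>S i\<close>, sends an
  isolating set to a transversal that is no larger.
\<close>

lemma graph_of_hypergraph: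
  fixes F :: "'b graph" and S :: "nat \<Rightarrow> nat set"
  assumes F: "nonnull_graph F" and d: "1 \<le> d" "d < a"
    and S: "\<And>i. i < b \<Longrightarrow> S i \<subseteq> {..<a} \<and> card (S i) = d"
    and transversal: "\<And>X. X \<subseteq> {..<a} \<Longrightarrow> (\<And>i. i < b \<Longrightarrow> S i \<inter> X \<noteq> {}) \<Longrightarrow> m < card X"
  obtains G :: "nat graph" where "nonnull_graph G" "d \<le> min_degree G"
    "card (verts G) = a + b * card (verts F)" "m < isolation_number G F"
proof -
  define k where "k = card (verts F)"
  have k: "0 < k" using F by (auto simp: k_def nonnull_graph_def fin_graph_def card_gt_0_iff)
  define C where "C = (\<lambda>i. {v. a \<le> v \<and> (v - a) div k = i})"
  have C_eq: "C i = {a + i * k..<a + i * k + k}" for i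
  proof (rule set_eqI)
    fix v
    have "(v - a) div k = i \<longleftrightarrow> i \<le> (v - a) div k \<and> (v - a) div k < Suc i" by auto
    also have "\<dots> \<longleftrightarrow> i * k \<le> v - a \<and> v - a < Suc i * k"
      using k by (simp only: less_eq_div_iff_mult_less_eq div_less_iff_less_mult)
    finally show "v \<in> C i \<longleftrightarrow> v \<in> {a + i * k..<a + i * k + k}"
      unfolding C_def mult_Suc mem_Collect_eq atLeastLessThan_iff by linarith
  qed
  define V where "V = {..<a + b * k}"
  define \<K> where "\<K> = insert {..<a} ((\<lambda>i. S i \<union> C i) ` {..<b})"
  define G where "G = clique_union V \<K>"
  have C_cover: "v \<in> C ((v - a) div k)" "(v - a) div k < b" if "v \<in> V" "a \<le> v" for v
    using that k by (auto simp: C_def V_def less_mult_imp_div_less)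
  have V: "finite V" "V \<noteq> {}" using d by (auto simp: V_def lessThan_empty_iff)
  have C_V: "C i \<subseteq> V" if "i < b" for i
  proof -
    have "Suc i * k \<le> b * k" using that by (intro mult_right_mono) auto
    then show ?thesis by (auto simp: C_eq V_def)
  qed
  have \<K>: "\<Union>\<K> = V"
  proof
    show "\<Union>\<K> \<subseteq> V"
      using S C_V by (fastforce simp: \<K>_def V_def)
    show "V \<subseteq> \<Union>\<K>"
    proof
      fix v assume "v \<in> V"
      then show "v \<in> \<Union>\<K>"
        using C_cover[of v] by (cases "v < a") (auto simp: \<K>_def)
    qed
  qed
  have large: "d < card K" if "K \<in> \<K>" for K
  proof -
    have "card (S i \<union> C i) = d + k" if "i < b" for i
    proof -
      have "S i \<inter> C i = {}" "finite (S i)"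
        using S[OF that] by (auto simp: C_def intro: finite_subset[OF _ finite_lessThan])
      then show ?thesis
        using S[OF that] by (simp add: card_Un_disjoint C_eq)
    qed
    then show ?thesis using that d k by (auto simp: \<K>_def)
  qed
  have "m < isolation_number G F"
  proof -
    obtain D where D: "isolating F G D" "card D = isolation_number G F"
      using isolation_number_attained[OF F] .
    have DV: "D \<subseteq> V" using D(1) by (simp add: isolating_def G_def)
    have meets: "D \<inter> (S i \<union> C i) \<noteq> {}" if i: "i < b" for i
    proof
      assume empty: "D \<inter> (S i \<union> C i) = {}"
      have only: "K = S i \<union> C i" if "K \<in> \<K>" "x \<in> K" "x \<in> C i" for K x
        using that S by (fastforce simp: \<K>_def C_def)
      have "x \<notin> closed_nbhd G D" if "x \<in> C i" for x
        using that empty only[OF _ _ that]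
        by (auto simp: closed_nbhd_def nbhd_def G_def clique_union_def)
      then have far: "C i \<inter> closed_nbhd G D = {}" by blast
      have "contains_copy (delete_verts G (closed_nbhd G D)) F"
      proof (rule contains_copy_if_clique)
        show "fin_graph F" using F by (simp add: nonnull_graph_def)
        show "finite (C i)" "card (C i) = card (verts F)" by (simp_all add: C_eq k_def)
        show "C i \<subseteq> verts (delete_verts G (closed_nbhd G D))"
          using C_V[OF i] far by (auto simp: delete_verts_def G_def)
        show "e \<in> edges (delete_verts G (closed_nbhd G D))" if "e \<subseteq> C i" "card e = 2" for e
          using that far i by (auto simp: delete_verts_def G_def clique_union_def \<K>_def)
      qed
      then show False using D(1) by (simp add: isolating_def)
    qed
    define h where "h = (\<lambda>v. if v < a then v else SOME u. u \<in> S ((v - a) div k))"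
    have pick: "(SOME u. u \<in> S i) \<in> S i" if "i < b" for i
    proof -
      have "S i \<noteq> {}" using S[OF that] d by auto
      then show ?thesis by (simp add: some_in_eq)
    qed
    have "m < card (h ` D)"
    proof (rule transversal)
      show "h ` D \<subseteq> {..<a}"
      proof (rule image_subsetI)
        fix v assume "v \<in> D"
        then have "v \<in> V" using DV by (rule subsetD[rotated])
        show "h v \<in> {..<a}"
        proof (cases "v < a")
          case False
          then have i: "(v - a) div k < b" using C_cover(2) \<open>v \<in> V\<close> by simp
          have "h v = (SOME u. u \<in> S ((v - a) div k))" using False by (simp add: h_def)
          then show ?thesis using pick[OF i] S[OF i] by (simp only:) blast
        qed (simp add: h_def)
      qed
      fix i assume i: "i < b"
      then obtain v where v: "v \<in> D" "v \<in> S i \<or> v \<in> C i" using meets by blast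
      then have "h v \<in> S i"
        using S[OF i] pick[OF i] by (auto simp: h_def C_def)
      then show "S i \<inter> h ` D \<noteq> {}" using v by blast
    qed
    moreover have "card (h ` D) \<le> card D"
      using DV V by (intro card_image_le) (auto intro: finite_subset)
    ultimately show ?thesis using D by simp
  qed
  moreover have "nonnull_graph G" "d \<le> min_degree G"
    using V \<K> large unfolding G_def by (simp_all add: nonnull_clique_union min_degree_clique_union)
  moreover have "card (verts G) = a + b * card (verts F)"
    by (simp add: G_def V_def k_def)
  ultimately show thesis using that by blast
qed

text \<open>
  The quotient of the two binomial coefficients is the probability that a random \<open>d\<close>-subset of
  \<open>a\<close> points misses a given set of size \<open>m\<close>. Drawing the points one by one, each of them misses it
  with conditional probability at least \<open>1 - m / (a - d)\<close>.
\<close>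

lemma binomial_ratio_lower_bound:
  assumes "m + d \<le> a" "d < a"
  shows "(1 - real m / (real a - real d)) ^ d * real (a choose d) \<le> real ((a - m) choose d)"
proof -
  let ?x = "1 - real m / (real a - real d)"
  have x: "0 \<le> ?x" using assms by (simp add: field_simps)
  have "?x ^ d * real (a choose d) = (\<Prod>i=0..<d. ?x * (real (a - i) / real (d - i)))"
    using assms by (simp only: binomial_altdef_of_nat less_imp_le prod.distrib) simp
  also have "\<dots> \<le> (\<Prod>i=0..<d. real (a - m - i) / real (d - i))"
  proof (rule prod_mono)
    fix i assume i: "i \<in> {0..<d}"
    have "?x * real (a - i) = real a - real i - real m * ((real a - real i) / (real a - real d))"
      using i assms by (simp add: algebra_simps)
    also have "\<dots> \<le> real a - real i - real m * 1"
      using i assms by (intro diff_left_mono mult_left_mono) (auto simp: field_simps)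
    also have "\<dots> = real (a - m - i)"
      using i assms by simp
    finally have "?x * real (a - i) / real (d - i) \<le> real (a - m - i) / real (d - i)"
      by (rule divide_right_mono) simp
    then show "0 \<le> ?x * (real (a - i) / real (d - i)) \<and>
        ?x * (real (a - i) / real (d - i)) \<le> real (a - m - i) / real (d - i)"
      using x by simp
  qed
  also have "\<dots> = real ((a - m) choose d)"
    using assms by (simp add: binomial_altdef_of_nat)
  finally show ?thesis .
qed

text \<open>
  Greedy covering leaves at most \<open>(1 - q)\<^sup>b a\<^sup>m \<le> exp (m ln a - q b) < 1\<close> of the \<open>m\<close>-sets meeting all
  chosen \<open>d\<close>-sets, that is, none. A smaller transversal would extend to one of size \<open>m\<close>.
\<close>

lemma large_transversal_family:
  fixes q :: real
  assumes "m + d \<le> a" "d < a"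
    and q: "q \<le> (1 - real m / (real a - real d)) ^ d" "0 < q"
    and b: "real m * ln (real a) < q * real b"
  obtains S where "\<And>i. i < b \<Longrightarrow> S i \<subseteq> {..<a} \<and> card (S i) = d"
    "\<And>X. X \<subseteq> {..<a} \<Longrightarrow> (\<And>i. i < b \<Longrightarrow> S i \<inter> X \<noteq> {}) \<Longrightarrow> m < card X"
proof -
  define P where "P = {X. X \<subseteq> {..<a} \<and> card X = m}"
  define Q where "Q = {Y. Y \<subseteq> {..<a} \<and> card Y = d}"
  have fin: "finite P" "finite Q" by (auto simp: P_def Q_def)
  have card: "card P = a choose m" "card Q = a choose d"
    by (simp_all add: P_def Q_def n_subsets)
  have "Q \<noteq> {}" using card assms by (metis card.empty less_imp_le zero_less_binomial order_less_irrefl)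
  have "q \<le> 1"
    using assms by (intro order_trans[OF q(1)] power_le_one) (auto simp: field_simps)
  have "\<exists>S. (\<forall>i<b. S i \<in> Q) \<and>
     real (card {X\<in>P. \<forall>i<b. \<not> (S i \<inter> X = {})}) \<le> (1 - q) ^ b * real (card P)"
  proof (rule greedy_covering)
    fix X assume "X \<in> P"
    then have X: "X \<subseteq> {..<a}" "card X = m" by (auto simp: P_def)
    have "{Y\<in>Q. Y \<inter> X = {}} = {Y. Y \<subseteq> {..<a} - X \<and> card Y = d}"
      by (auto simp: Q_def)
    moreover have "card ({..<a} - X) = a - m"
      using X by (simp add: card_Diff_subset finite_subset[OF X(1)])
    ultimately have "card {Y\<in>Q. Y \<inter> X = {}} = (a - m) choose d"
      using n_subsets[of "{..<a} - X" d] by simp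
    moreover have "q * real (card Q) \<le> real ((a - m) choose d)"
      using order_trans[OF mult_right_mono[OF q(1)] binomial_ratio_lower_bound[OF assms(1,2)]]
      by (simp add: card)
    ultimately show "q * real (card Q) \<le> real (card {Y\<in>Q. Y \<inter> X = {}})" by simp
  qed fact+
  then obtain S where S: "\<And>i. i < b \<Longrightarrow> S i \<in> Q"
    and le: "real (card {X\<in>P. \<forall>i<b. S i \<inter> X \<noteq> {}}) \<le> (1 - q) ^ b * real (card P)" by blast
  have "(1 - q) ^ b * real (card P) \<le> exp (- q) ^ b * real a ^ m"
  proof (intro mult_mono power_mono)
    show "1 - q \<le> exp (- q)" using exp_ge_add_one_self[of "- q"] by simp
    show "real (card P) \<le> real a ^ m"
      using binomial_le_pow[of m a] assms by (simp add: card flip: of_nat_power)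
  qed (use \<open>q \<le> 1\<close> in auto)
  also have "\<dots> = exp (real m * ln (real a) - q * real b)"
    using assms by (simp add: exp_diff exp_of_nat_mult exp_minus divide_inverse power_inverse mult.commute[of q])
  also have "\<dots> < 1" using b by simp
  finally have "card {X\<in>P. \<forall>i<b. S i \<inter> X \<noteq> {}} = 0"
    using le by linarith
  then have none: "{X\<in>P. \<forall>i<b. S i \<inter> X \<noteq> {}} = {}"
    by (subst (asm) card_0_eq) (use fin in auto)
  show thesis
  proof (rule that)
    show "S i \<subseteq> {..<a} \<and> card (S i) = d" if "i < b" for i
      using S[OF that] by (simp add: Q_def)
    fix X assume X: "X \<subseteq> {..<a}" "\<And>i. i < b \<Longrightarrow> S i \<inter> X \<noteq> {}"
    show "m < card X"
    proof (rule ccontr)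
      assume "\<not> m < card X"
      then obtain Z where Z: "X \<subseteq> Z" "Z \<subseteq> {..<a}" "card Z = m"
        using exists_subset_between[of X m "{..<a}"] X(1) assms by auto
      then have "Z \<in> {X\<in>P. \<forall>i<b. S i \<inter> X \<noteq> {}}"
        using X(2) by (fastforce simp: P_def)
      then show False using none by blast
    qed
  qed
qed

text \<open>
  Here \<open>\<mu>\<close>, \<open>\<beta>\<close> and \<open>q\<close> are the real versions of the parameters: lower bound for the
  transversal number, number of hyperedges, and lower bound for the fraction of \<open>d\<close>-subsets missing a set of size \<open>\<mu>\<close>. That fraction
  is about \<open>d powr - (1 - \<epsilon>)\<close>; the weaker exponent \<open>1 - \<epsilon> / 2\<close> absorbs lower order terms and
  still gives \<open>\<beta> = O(d powr (2 - \<epsilon> / 2) (ln d)\<^sup>2)\<close>, so that the attached cliques are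
  negligible against the \<open>d\<^sup>2\<close> ground vertices.
\<close>

lemma iota_ge_asymptotic:
  fixes F :: "'b graph" and \<epsilon> :: real
  assumes F: "nonnull_graph F" and \<epsilon>: "0 < \<epsilon>" "\<epsilon> < 1"
  shows "eventually (\<lambda>d. (1 - 2 * \<epsilon>) * alpha d \<le> iota d F) sequentially"
proof -
  define k where "k = real (card (verts F))"
  define \<mu> where "\<mu> = (\<lambda>d :: nat. (1 - \<epsilon>) * real d * ln (real d))"
  define q where "q = (\<lambda>d :: nat. real d powr (- (1 - \<epsilon> / 2)))"
  define \<beta> where "\<beta> = (\<lambda>d :: nat. 2 * \<mu> d * ln (real d) / q d)"
  have k: "0 \<le> k" by (simp add: k_def)
  have ev1: "eventually (\<lambda>d. q d \<le> exp (real d * ln (1 - \<mu> d / (real d ^ 2 - real d)))) sequentially"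
  proof -
    have "((\<lambda>d :: nat. real d * ln (1 - \<mu> d / (real d ^ 2 - real d)) / ln (real d)) \<longlongrightarrow> \<epsilon> - 1) sequentially"
      unfolding \<mu>_def using \<epsilon> by real_asymp
    then have "eventually (\<lambda>d. - (1 - \<epsilon> / 2) < real d * ln (1 - \<mu> d / (real d ^ 2 - real d)) / ln (real d)) sequentially"
      using \<epsilon> by (intro order_tendstoD(1)) auto
    then show ?thesis
      using eventually_ge_at_top[of 2]
    proof eventually_elim
      case (elim d)
      then have "- (1 - \<epsilon> / 2) * ln (real d) < real d * ln (1 - \<mu> d / (real d ^ 2 - real d))"
        by (simp add: pos_less_divide_eq)
      then show ?case using elim(2) by (simp add: q_def powr_def)
    qed
  qed
  have ev2: "eventually (\<lambda>d. \<mu> d < real d ^ 2 - real d) sequentially"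
    unfolding \<mu>_def using \<epsilon> by real_asymp
  have "((\<lambda>d. \<mu> d / (real d ^ 2 + k * (\<beta> d + 1)) / alpha d) \<longlongrightarrow> 1 - \<epsilon>) sequentially"
    unfolding \<mu>_def \<beta>_def q_def alpha_def using \<epsilon> k by real_asymp
  then have ev3: "eventually (\<lambda>d. 1 - 2 * \<epsilon> < \<mu> d / (real d ^ 2 + k * (\<beta> d + 1)) / alpha d) sequentially"
    using \<epsilon> by (intro order_tendstoD(1)) auto
  show ?thesis
    using ev1 ev2 ev3 eventually_ge_at_top[of 2]
  proof eventually_elim
    case (elim d)
    define a where "a = d ^ 2"
    define m where "m = nat \<lfloor>\<mu> d\<rfloor>"
    define b where "b = Suc (nat \<lfloor>\<beta> d\<rfloor>)"
    have d: "1 \<le> d" "d < a" using elim(4) by (auto simp: a_def power2_eq_square)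
    have q: "0 < q d" using d by (simp add: q_def)
    have \<mu>: "0 \<le> \<mu> d" using \<epsilon> d by (simp add: \<mu>_def)
    have \<beta>: "0 \<le> \<beta> d" using q \<mu> d by (simp add: \<beta>_def)
    have m: "real m \<le> \<mu> d" "\<mu> d < real m + 1"
      using \<mu> unfolding m_def by linarith+
    have b: "\<beta> d < real b" "real b \<le> \<beta> d + 1"
      using \<beta> unfolding b_def by linarith+
    have pos: "0 < real a - real d" using d by simp
    have "real m + real d \<le> real a"
      using m elim(2) by (simp add: a_def)
    then have mda: "m + d \<le> a" by linarith
    have "q d \<le> exp (ln (1 - \<mu> d / (real a - real d))) ^ d"
      using elim(1) by (simp add: a_def exp_of_nat_mult)
    also have "\<dots> = (1 - \<mu> d / (real a - real d)) ^ d"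
      using elim(2) pos by (simp add: a_def)
    also have "\<dots> \<le> (1 - real m / (real a - real d)) ^ d"
      using elim(2) pos m by (intro power_mono diff_left_mono divide_right_mono) (auto simp: a_def)
    finally have q_le: "q d \<le> (1 - real m / (real a - real d)) ^ d" .
    have "real m * ln (real a) \<le> 2 * \<mu> d * ln (real d)"
      using m d by (simp add: a_def ln_realpow mult_right_mono)
    also have "\<dots> = q d * \<beta> d" using q by (simp add: \<beta>_def)
    also have "\<dots> < q d * real b" using q b by simp
    finally have qb: "real m * ln (real a) < q d * real b" .
    obtain S where "\<And>i. i < b \<Longrightarrow> S i \<subseteq> {..<a} \<and> card (S i) = d"
      "\<And>X. X \<subseteq> {..<a} \<Longrightarrow> (\<And>i. i < b \<Longrightarrow> S i \<inter> X \<noteq> {}) \<Longrightarrow> m < card X"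
      using large_transversal_family[OF mda d(2) q_le q qb] by blast
    then obtain G :: "nat graph" where G: "nonnull_graph G" "d \<le> min_degree G"
      "card (verts G) = a + b * card (verts F)" "m < isolation_number G F"
      using graph_of_hypergraph[OF F d] by blast
    have n: "real (card (verts G)) \<le> real d ^ 2 + k * (\<beta> d + 1)"
      using mult_left_mono[OF b(2) k] by (simp add: G(3) a_def k_def mult.commute)
    have n0: "0 < real d ^ 2 + k * (\<beta> d + 1)"
      using d k \<beta> by (intro add_pos_nonneg) auto
    let ?x = "\<mu> d / (real d ^ 2 + k * (\<beta> d + 1))"
    have "?x * real (card (verts G)) \<le> ?x * (real d ^ 2 + k * (\<beta> d + 1))"
      using n n0 \<mu> by (intro mult_left_mono) auto
    also have "\<dots> = \<mu> d" using n0 by simp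
    also have "\<dots> \<le> real (isolation_number G F)" using m G(4) by linarith
    finally have "?x \<le> iota d F" by (rule iota_ge[OF F G(1,2)])
    moreover have "(1 - 2 * \<epsilon>) * alpha d < ?x"
      using elim(3) alpha_pos[of d] by (simp only: pos_less_divide_eq)
    ultimately show ?case by linarith
  qed
qed

theorem theorem4:
  fixes F :: "'b graph"
  assumes "nonnull_graph F"
  shows "\<exists>\<epsilon> :: nat \<Rightarrow> real. \<epsilon> \<longlonglongrightarrow> 0 \<and>
    (\<forall>d\<ge>1. (1 + \<epsilon> d) / real (card (verts F)) * alpha d \<le> iota d F \<and> iota d F \<le> alpha d)"
proof -
  define k where "k = real (card (verts F))"
  have k: "1 \<le> k"
    using assms by (auto simp: k_def nonnull_graph_def fin_graph_def card_gt_0_iff Suc_le_eq)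
  \<comment> \<open>The relative error of the approximation \<open>\<alpha>\<^sub>d\<close>; dividing by \<open>|V(F)|\<close> is harmless as \<open>iota\<close> is
      nonnegative.\<close>
  define \<epsilon> where "\<epsilon> = (\<lambda>d. iota d F / alpha d - 1)"
  have upper: "\<epsilon> d \<le> 0" for d
    using iota_le_alpha[OF assms, of d] alpha_pos[of d] by (simp add: \<epsilon>_def)
  have "\<epsilon> \<longlonglongrightarrow> 0"
  proof (rule order_tendstoI)
    fix x :: real assume "x < 0"
    define y where "y = min (1 / 2) (- x / 3)"
    have y: "0 < y" "y < 1" "x < - 2 * y" using \<open>x < 0\<close> by (auto simp: y_def min_def)
    show "eventually (\<lambda>d. x < \<epsilon> d) sequentially"
      using iota_ge_asymptotic[OF assms y(1,2)]
    proof eventually_elim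
      case (elim d)
      then have "1 - 2 * y \<le> iota d F / alpha d" using alpha_pos[of d] by (simp add: pos_le_divide_eq)
      then show ?case using y(3) by (simp add: \<epsilon>_def)
    qed
  next
    fix x :: real assume "0 < x"
    then show "eventually (\<lambda>d. \<epsilon> d < x) sequentially"
      using upper le_less_trans by (intro always_eventually) blast
  qed
  moreover have "(1 + \<epsilon> d) / real (card (verts F)) * alpha d \<le> iota d F" for d
  proof -
    have "(1 + \<epsilon> d) / k * alpha d = iota d F / k"
      using alpha_pos[of d] by (simp add: \<epsilon>_def)
    also have "\<dots> \<le> iota d F / 1"
      using k iota_nonneg[OF assms] by (intro divide_left_mono) auto
    finally show ?thesis by (simp add: k_def)
  qed
  ultimately show ?thesis
    using iota_le_alpha[OF assms] by blast
qed

end
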